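(* Let $\mathcal{M}$ be a compact connected metric measure space, with metric $\theta$ and measure $\mu$ normalized by $\operatorname{diam}\mathcal{M}=1$ and $\mu(\mathcal{M})=1$, satisfying Condition A (with exponent $d$) and Condition B. Then there are constants $c_4,c_5>0$ depending only on $\mathcal{M}$ such that for every integer $N\ge1$, every $N$-point subset $\mathcal{D}_N\subset\mathcal{M}$, every $1<p<\infty$ and every integer $m\ge c_5$, $$\mathcal{L}_\infty[\mathcal{M},\mathcal{D}_N]\le 2m^{2/p}\,\mathcal{L}_p[\mathcal{M},\xi_0,\mathcal{D}_N]+c_4\,N\,m^{-1/d},$$ where $\xi_0$ is the standard Lebesgue measure on $[0,1]$. In particular, for every such $N,p,m$, $$\lambda_\infty[\mathcal{M},N]\le 2m^{2/p}\,\lambda_p[\mathcal{M},\xi_0,N]+c_4\,N\,m^{-1/d}.$$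
   Context: $\mathcal{M}$ is a compact metric space with metric $\theta$ and a finite non-negative Borel measure $\mu$, normalized by $\mu(\mathcal{M})=1$ and $\operatorname{diam}\mathcal{M}=\sup\{\theta(y_1,y_2):y_1,y_2\in\mathcal{M}\}=1$. Put $I=[0,1]$. Balls: $B(y,r)=\{x\in\mathcal{M}:\theta(x,y)<r\}$ and $v(y,r)=\mu(B(y,r))$, with the convention that $B(y,r)=\emptyset$, $v(y,r)=0$ if $r\le 0$, and $B(y,r)=\mathcal{M}$, $v(y,r)=1$ if $r\ge 1$. Condition A: there are positive constants $d$ and $c_1$ such that $c_1^{-1}r^d\le v(y,r)\le c_1r^d$ for all $y\in\mathcal{M}$, $r\in I$. Condition B: there is a constant $c_2>0$ such that $|v(y,r_1)-v(y,r_2)|\le c_2|r_1-r_2|$ for all $y\in\mathcal{M}$ and $r_1,r_2\in I$. Constants "depending only on $\mathcal{M}$" depend on the metric measure space $\mathcal M$ (including $\theta,\mu,d,c_1,c_2$) and not on $N$, $p$, $m$, $\mathcal{D}_N$. For an $N$-point subset $\mathcal{D}_N\subset\mathcal{M}$ the local discrepancy is $L[B(y,r),\mathcal{D}_N]=\#(B(y,r)\cap\mathcal{D}_N)-N\,v(y,r)$. For $0<p<\infty$ and a non-negative Borel measure $\xi$ on $I$ with $\xi(I)=1$, $$\mathcal{L}_p[\mathcal{M},\xi,\mathcal{D}_N]=\left(\iint_{\mathcal{M}\times I}|L[B(y,r),\mathcal{D}_N]|^p\,d\mu(y)\,d\xi(r)\right)^{1/p},$$ and $\mathcal{L}_\infty[\mathcal{M},\mathcal{D}_N]=\sup_{y\in\mathcal{M},\,r\in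 I}|L[B(y,r),\mathcal{D}_N]|$. Further, $\lambda_p[\mathcal{M},\xi,N]=\inf_{\mathcal{D}_N}\mathcal{L}_p[\mathcal{M},\xi,\mathcal{D}_N]$ and $\lambda_\infty[\mathcal{M},N]=\inf_{\mathcal{D}_N}\mathcal{L}_\infty[\mathcal{M},\mathcal{D}_N]$, the infima being over all $N$-point subsets of $\mathcal{M}$. *)

theory Defs
  imports "HOL-Analysis.Analysis"
begin

text \<open>
  The space \<open>M\<close> is a subset of a metric space type, with the induced metric; the measure
  \<open>\<mu>\<close> lives on the Borel sets of \<open>M\<close>, so that \<open>space \<mu> = M\<close>.
\<close>

definition normalized_metric_measure_space :: "'a::metric_space set \<Rightarrow> 'a measure \<Rightarrow> bool" where
  "normalized_metric_measure_space M \<mu> \<longleftrightarrow>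
     compact M \<and> diameter M = 1 \<and>
     sets \<mu> = sets (restrict_space borel M) \<and> emeasure \<mu> M = 1"

text \<open>
  Since \<open>diameter M = 1\<close>, the convention for \<open>r \<ge> 1\<close> makes a difference only at \<open>r = 1\<close>, where
  \<open>{x \<in> M. dist x y < 1}\<close> may be a proper subset of \<open>M\<close>.
\<close>

definition mball_conv :: "'a::metric_space set \<Rightarrow> 'a \<Rightarrow> real \<Rightarrow> 'a set" where
  "mball_conv M y r =
     (if r \<le> 0 then {} else if r \<ge> 1 then M else {x \<in> M. dist x y < r})"

definition ball_vol :: "'a::metric_space set \<Rightarrow> 'a measure \<Rightarrow> 'a \<Rightarrow> real \<Rightarrow> real" where
  "ball_vol M \<mu> y r = measure \<mu> (mball_conv M y r)"

definition condition_A :: "'a::metric_space set \<Rightarrow> 'a measure \<Rightarrow> real \<Rightarrow> real \<Rightarrow> bool" where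
  "condition_A M \<mu> d c1 \<longleftrightarrow> d > 0 \<and> c1 > 0 \<and>
     (\<forall>y\<in>M. \<forall>r\<in>{0..1}.
        inverse c1 * r powr d \<le> ball_vol M \<mu> y r \<and> ball_vol M \<mu> y r \<le> c1 * r powr d)"

definition condition_B :: "'a::metric_space set \<Rightarrow> 'a measure \<Rightarrow> real \<Rightarrow> bool" where
  "condition_B M \<mu> c2 \<longleftrightarrow> c2 > 0 \<and>
     (\<forall>y\<in>M. \<forall>r1\<in>{0..1}. \<forall>r2\<in>{0..1}.
        \<bar>ball_vol M \<mu> y r1 - ball_vol M \<mu> y r2\<bar> \<le> c2 * \<bar>r1 - r2\<bar>)"

definition point_sets :: "'a set \<Rightarrow> nat \<Rightarrow> 'a set set" where
  "point_sets M N = {D. D \<subseteq> M \<and> finite D \<and> card D = N}"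

definition local_discrepancy ::
    "'a::metric_space set \<Rightarrow> 'a measure \<Rightarrow> 'a set \<Rightarrow> 'a \<Rightarrow> real \<Rightarrow> real" where
  "local_discrepancy M \<mu> D y r =
     real (card (mball_conv M y r \<inter> D)) - real (card D) * ball_vol M \<mu> y r"

text \<open>
  For finite \<open>D\<close> and a Borel probability measure \<open>\<xi>\<close> on \<open>[0,1]\<close> the integrand is bounded
  and Borel measurable in \<open>(y, r)\<close>, so the Bochner integral below is the usual one; the suprema
  and infima are those of bounded sets of reals.
\<close>

definition Lp_discrepancy ::
    "'a::metric_space set \<Rightarrow> 'a measure \<Rightarrow> real measure \<Rightarrow> real \<Rightarrow> 'a set \<Rightarrow> real" where
  "Lp_discrepancy M \<mu> \<xi> p D =
     (LINT (y, r)|(\<mu> \<Otimes>\<^sub>M \<xi>). \<bar>local_discrepancy M \<mu> D y r\<bar> powr p) powr (1 / p)"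

definition Linf_discrepancy :: "'a::metric_space set \<Rightarrow> 'a measure \<Rightarrow> 'a set \<Rightarrow> real" where
  "Linf_discrepancy M \<mu> D =
     (SUP (y, r) \<in> M \<times> {0..1}. \<bar>local_discrepancy M \<mu> D y r\<bar>)"

definition lambda_p ::
    "'a::metric_space set \<Rightarrow> 'a measure \<Rightarrow> real measure \<Rightarrow> real \<Rightarrow> nat \<Rightarrow> real" where
  "lambda_p M \<mu> \<xi> p N = (INF D \<in> point_sets M N. Lp_discrepancy M \<mu> \<xi> p D)"

definition lambda_inf :: "'a::metric_space set \<Rightarrow> 'a measure \<Rightarrow> nat \<Rightarrow> real" where
  "lambda_inf M \<mu> N = (INF D \<in> point_sets M N. Linf_discrepancy M \<mu> D)"

definition xi0 :: "real measure" where
  "xi0 = restrict_space lborel {0..1}"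

end

theory Submission
  imports Defs
begin

text \<open>
  If \<open>dist y y\<^sub>0 < \<delta>\<close> and \<open>r\<^sub>0 + \<delta> \<le> r \<le> r\<^sub>0 + 2\<delta>\<close>, then \<open>B(y\<^sub>0, r\<^sub>0) \<subseteq> B(y, r)\<close>, while Condition B bounds
  the increase of the volume by \<open>3 c\<^sub>2 \<delta>\<close>. So a large positive discrepancy at \<open>(y\<^sub>0, r\<^sub>0)\<close> persists,
  up to \<open>3 c\<^sub>2 \<delta> N\<close>, on a set of measure at least \<open>\<delta>\<^bsup>d + 1\<^esup> / c\<^sub>1\<close>; a negative one persists for
  \<open>r\<^sub>0 - 2\<delta> \<le> r \<le> r\<^sub>0 - \<delta>\<close>, and when the range of radii leaves \<open>[0, 1]\<close> the discrepancy is trivially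
  small. With \<open>\<delta>\<close> a multiple of \<open>m\<^bsup>-1/d\<^esup>\<close> this set has measure at least \<open>m\<^bsup>-2\<^esup>\<close>, because Conditions A
  and B together force \<open>d \<ge> 1\<close>. Markov's inequality concludes.
\<close>

section \<open>Markov's inequality and measurability of Caratheodory functions\<close>

text \<open>Markov's inequality in norm form. The bound \<open>B\<close> makes
  \<open>\<bar>f x\<bar> powr p\<close> integrable; without integrability the Bochner integral would
  default to 0.\<close>

lemma (in finite_measure) lower_bound_le_Lp_norm:
  fixes f :: "'a \<Rightarrow> real"
  assumes f: "f \<in> borel_measurable M" and bdd: "\<And>x. x \<in> space M \<Longrightarrow> \<bar>f x\<bar> \<le> B"
    and E: "E \<in> sets M" and t: "t \<ge> 0" "\<And>x. x \<in> E \<Longrightarrow> t \<le> \<bar>f x\<bar>"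
    and p: "p > 0" and e: "0 \<le> e" "e \<le> measure M E"
  shows "t * e powr (1 / p) \<le> (\<integral>x. \<bar>f x\<bar> powr p \<partial>M) powr (1 / p)"
proof -
  have int: "integrable M (\<lambda>x. \<bar>f x\<bar> powr p)"
    using f p bdd by (intro integrable_const_bound[where B = "B powr p"] AE_I2) (auto intro: powr_mono2)
  have "t powr p * e \<le> t powr p * measure M E"
    using e by (intro mult_left_mono) auto
  also have "\<dots> = (\<integral>x. t powr p * indicator E x \<partial>M)"
    using E by simp
  also have "\<dots> \<le> (\<integral>x. \<bar>f x\<bar> powr p \<partial>M)"
  proof (rule integral_mono[OF _ int])
    show "integrable M (\<lambda>x. t powr p * indicator E x)"
      using E by (intro integrable_mult_right integrable_real_indicator) (simp_all add: less_top[symmetric])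
    show "t powr p * indicator E x \<le> \<bar>f x\<bar> powr p" for x
      using t p by (auto simp: indicator_def intro!: powr_mono2)
  qed
  finally have "(t powr p * e) powr (1 / p) \<le> (\<integral>x. \<bar>f x\<bar> powr p \<partial>M) powr (1 / p)"
    using e p by (intro powr_mono2) auto
  then show ?thesis
    using t e p by (simp add: powr_mult powr_powr)
qed

text \<open>Rounding the second variable down to ever finer grids gives measurable functions, and
  these converge pointwise by continuity.\<close>

lemma borel_measurable_caratheodory:
  fixes f :: "'a \<Rightarrow> real \<Rightarrow> real"
  assumes meas: "\<And>r. r \<in> {0..1} \<Longrightarrow> (\<lambda>y. f y r) \<in> borel_measurable N"
    and cont: "\<And>y. y \<in> space N \<Longrightarrow> continuous_on {0..1} (f y)"
  shows "(\<lambda>(y, r). f y r) \<in> borel_measurable (N \<Otimes>\<^sub>M restrict_space borel {0..1})"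
proof (rule borel_measurable_LIMSEQ_real)
  define g :: "nat \<Rightarrow> real \<Rightarrow> real" where "g n r = of_int \<lfloor>real (Suc n) * r\<rfloor> / real (Suc n)" for n r
  have g_le: "g n r \<le> r" for n r
    unfolding g_def by (subst pos_divide_le_eq) (auto simp del: of_nat_Suc simp: mult.commute)
  have g_ge: "r - inverse (real (Suc n)) \<le> g n r" for n r
  proof -
    have "real (Suc n) * r - 1 \<le> of_int \<lfloor>real (Suc n) * r\<rfloor>"
      by linarith
    then have "(real (Suc n) * r - 1) / real (Suc n) \<le> g n r"
      unfolding g_def by (rule divide_right_mono) simp
    then show ?thesis
      by (simp add: diff_divide_distrib inverse_eq_divide del: of_nat_Suc)
  qed
  have g_01: "g n r \<in> {0..1}" if "r \<in> {0..1}" for n r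
  proof -
    have "0 \<le> g n r"
      using that by (simp add: g_def)
    then show ?thesis
      using that g_le[of n r] by simp
  qed
  show "(\<lambda>n. (\<lambda>(y, r). f y (g n r)) x) \<longlonglongrightarrow> (\<lambda>(y, r). f y r) x"
    if x: "x \<in> space (N \<Otimes>\<^sub>M restrict_space borel {0..1})" for x
  proof -
    obtain y r where yr: "x = (y, r)" "y \<in> space N" "r \<in> {0..1}"
      using x by (auto simp: space_pair_measure space_restrict_space)
    have lim: "(\<lambda>n. r - inverse (real (Suc n))) \<longlonglongrightarrow> r"
      using tendsto_diff[OF tendsto_const[of r] LIMSEQ_inverse_real_of_nat] by simp
    have "(\<lambda>n. g n r) \<longlonglongrightarrow> r"
      by (rule tendsto_sandwich[OF _ _ lim tendsto_const]) (simp_all only: g_le g_ge eventually_True)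
    then have "(\<lambda>n. f y (g n r)) \<longlonglongrightarrow> f y r"
      using yr g_01 by (intro continuous_on_tendsto_compose[OF cont]) (auto intro: always_eventually)
    then show ?thesis
      by (simp add: yr)
  qed
  show "(\<lambda>(y, r). f y (g n r)) \<in> borel_measurable (N \<Otimes>\<^sub>M restrict_space borel {0..1})" for n
  proof -
    let ?P = "N \<Otimes>\<^sub>M restrict_space borel {0..1::real}"
    \<comment> \<open>Freezing the second variable at the grid value k/(n+1), with default 0 outside
      [0,1], is measurable for every integer \<open>k\<close>; these countably many functions are
      then glued along the floor.\<close>
    define h where "h k x = (if real_of_int k / real (Suc n) \<in> {0..1}
      then f (fst x) (real_of_int k / real (Suc n)) else 0)" for k :: int and x :: "'a \<times> real"
    have h: "h k \<in> borel_measurable ?P" for k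
    proof (cases "real_of_int k / real (Suc n) \<in> {0..1}")
      case True
      then have "h k = (\<lambda>x. f (fst x) (real_of_int k / real (Suc n)))"
        by (simp add: h_def fun_eq_iff)
      then show ?thesis
        using measurable_compose[OF measurable_fst meas[OF True]] by metis
    next
      case False
      then have "h k = (\<lambda>x. 0)"
        by (auto simp: h_def fun_eq_iff)
      then show ?thesis
        by simp
    qed
    have snd: "snd \<in> borel_measurable ?P"
      by (rule measurable_compose[OF measurable_snd measurable_restrict_space1]) simp
    have "(\<lambda>x. \<lfloor>real (Suc n) * snd x\<rfloor>) \<in> ?P \<rightarrow>\<^sub>M count_space UNIV"
      by (rule measurable_compose[OF _ measurable_real_floor]) (intro borel_measurable_times snd measurable_const, simp)
    with h have "(\<lambda>x. h \<lfloor>real (Suc n) * snd x\<rfloor> x) \<in> borel_measurable ?P"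
      by (rule measurable_compose_countable)
    moreover have "h \<lfloor>real (Suc n) * snd x\<rfloor> x = (\<lambda>(y, r). f y (g n r)) x" if "x \<in> space ?P" for x
      using that g_01[of "snd x" n]
      by (auto simp: h_def g_def space_pair_measure space_restrict_space simp del: of_nat_Suc)
    ultimately show ?thesis
      by (simp cong: measurable_cong)
  qed
qed

section \<open>Balls and their volumes\<close>

locale ball_lipschitz_space =
  fixes M :: "'a::metric_space set" and \<mu> :: "'a measure" and c2 :: real
  assumes normalized: "normalized_metric_measure_space M \<mu>"
    and lipschitz: "condition_B M \<mu> c2"
begin

lemma sets_\<mu>: "sets \<mu> = sets (restrict_space borel M)"
  and diameter: "diameter M = 1"
  using normalized by (auto simp: normalized_metric_measure_space_def)

lemma c2_pos: "c2 > 0"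
  using lipschitz by (simp add: condition_B_def)

lemma space_\<mu>: "space \<mu> = M"
  using sets_eq_imp_space_eq[OF sets_\<mu>] by (simp add: space_restrict_space)

lemma nonempty: "M \<noteq> {}"
  using diameter by auto

text \<open>A finite connected space has at most one point, which diameter 1 rules out. This
  supplies \<open>N\<close>-point subsets for every \<open>N\<close>.\<close>

lemma infinite_carrier: "connected M \<Longrightarrow> infinite M"
  using diameter connected_finite_iff_sing[of M] by auto

sublocale finite_measure \<mu>
  using normalized by (intro finite_measureI) (simp add: space_\<mu> normalized_metric_measure_space_def)

sublocale xi0: finite_measure xi0
  unfolding xi0_def by (intro finite_measureI) (simp add: space_restrict_space emeasure_restrict_space)

sublocale prod: finite_measure "\<mu> \<Otimes>\<^sub>M xi0"
  by (intro finite_measure_pair_measure) unfold_locales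

lemma measure_carrier: "measure \<mu> M = 1"
  using normalized by (simp add: measure_def normalized_metric_measure_space_def)

lemma mball_conv_sets: "mball_conv M y r \<in> sets \<mu>"
proof -
  have "mball_conv M y r = M \<inter> (if r \<le> 0 then {} else if r \<ge> 1 then UNIV else ball y r)"
    by (auto simp: mball_conv_def dist_commute)
  moreover have "(if r \<le> 0 then {} else if r \<ge> 1 then UNIV else ball y r) \<in> sets borel"
    by simp
  ultimately show ?thesis
    unfolding sets_\<mu> sets_restrict_space by (rule image_eqI)
qed

text \<open>Triangle inequality. The conventions are respected because \<open>0 < r\<close> forces
  \<open>0 < s\<close>, and the target is all of \<open>M\<close> once
  \<open>s \<ge> 1\<close>.\<close>

lemma mball_conv_mono: "dist y z + r \<le> s \<Longrightarrow> mball_conv M y r \<subseteq> mball_conv M z s"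
proof
  fix x assume le: "dist y z + r \<le> s" and x: "x \<in> mball_conv M y r"
  have "x \<in> M" "0 < r" and cases: "1 \<le> r \<or> dist x y < r"
    using x by (auto simp: mball_conv_def split: if_splits)
  moreover have "r \<le> s"
    using le zero_le_dist[of y z] by linarith
  moreover have "1 \<le> s \<or> dist x z < s"
    using le cases \<open>r \<le> s\<close> dist_triangle[of x z y] by linarith
  ultimately show "x \<in> mball_conv M z s"
    by (auto simp: mball_conv_def)
qed

lemma ball_vol_mono: "dist y z + r \<le> s \<Longrightarrow> ball_vol M \<mu> y r \<le> ball_vol M \<mu> z s"
  unfolding ball_vol_def by (rule finite_measure_mono[OF mball_conv_mono mball_conv_sets])

lemma ball_vol_le_1: "ball_vol M \<mu> y r \<le> 1"
  using bounded_measure[of "mball_conv M y r"] by (simp add: ball_vol_def space_\<mu> measure_carrier)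

lemma ball_vol_nonneg: "0 \<le> ball_vol M \<mu> y r"
  by (simp add: ball_vol_def)

lemma ball_vol_0: "r \<le> 0 \<Longrightarrow> ball_vol M \<mu> y r = 0"
  by (simp add: ball_vol_def mball_conv_def)

lemma ball_vol_1: "1 \<le> r \<Longrightarrow> ball_vol M \<mu> y r = 1"
  by (simp add: ball_vol_def mball_conv_def measure_carrier)

text \<open>Condition B covers radii in [0,1], but the volume is constant beyond either end and
  clipping is 1-Lipschitz. Unrestricted radii matter since enlarging a ball can push its radius past
  1.\<close>

lemma ball_vol_lipschitz_radius:
  assumes y: "y \<in> M"
  shows "\<bar>ball_vol M \<mu> y r - ball_vol M \<mu> y s\<bar> \<le> c2 * \<bar>r - s\<bar>"
proof -
  define clip :: "real \<Rightarrow> real" where "clip r = max 0 (min 1 r)" for r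
  have "ball_vol M \<mu> y (clip r) = ball_vol M \<mu> y r" for r
    by (auto simp: clip_def ball_vol_0 ball_vol_1 max_def min_def)
  then have "\<bar>ball_vol M \<mu> y r - ball_vol M \<mu> y s\<bar> = \<bar>ball_vol M \<mu> y (clip r) - ball_vol M \<mu> y (clip s)\<bar>"
    by simp
  also have "\<dots> \<le> c2 * \<bar>clip r - clip s\<bar>"
    using lipschitz y by (auto simp: condition_B_def clip_def)
  also have "\<dots> \<le> c2 * \<bar>r - s\<bar>"
    using c2_pos by (intro mult_left_mono) (auto simp: clip_def)
  finally show ?thesis .
qed

text \<open>The ball around \<open>y\<close> lies in the ball around \<open>z\<close> of radius
  \<open>dist y z + r\<close>, so moving the centre is reduced to changing the radius.\<close>

lemma ball_vol_diff_le:
  assumes "z \<in> M"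
  shows "ball_vol M \<mu> y r - ball_vol M \<mu> z s \<le> c2 * \<bar>dist y z + r - s\<bar>"
  using ball_vol_mono[of y z r "dist y z + r"]
    ball_vol_lipschitz_radius[OF assms, of "dist y z + r" s] by auto

lemma ball_vol_lipschitz_center:
  assumes "y \<in> M" "z \<in> M"
  shows "\<bar>ball_vol M \<mu> y r - ball_vol M \<mu> z r\<bar> \<le> c2 * dist y z"
  using ball_vol_diff_le[OF assms(1), of z r r] ball_vol_diff_le[OF assms(2), of y r r]
  by (simp add: dist_commute)

section \<open>Joint measurability of the discrepancy\<close>

lemma ball_vol_measurable:
  "(\<lambda>(y, r). ball_vol M \<mu> y r) \<in> borel_measurable (\<mu> \<Otimes>\<^sub>M restrict_space borel {0..1})"
proof (rule borel_measurable_caratheodory)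
  fix r :: real
  have "c2-lipschitz_on M (\<lambda>y. ball_vol M \<mu> y r)"
    using ball_vol_lipschitz_center c2_pos by (intro lipschitz_onI) (auto simp: dist_real_def)
  then have "(\<lambda>y. ball_vol M \<mu> y r) \<in> borel_measurable (restrict_space borel M)"
    by (intro borel_measurable_continuous_on_restrict lipschitz_on_continuous_on)
  then show "(\<lambda>y. ball_vol M \<mu> y r) \<in> borel_measurable \<mu>"
    by (simp add: measurable_cong_sets[OF sets_\<mu> refl])
next
  fix y assume "y \<in> space \<mu>"
  then have "c2-lipschitz_on {0..1} (ball_vol M \<mu> y)"
    using ball_vol_lipschitz_radius c2_pos
    by (intro lipschitz_onI) (auto simp: dist_real_def space_\<mu>)
  then show "continuous_on {0..1} (ball_vol M \<mu> y)"
    by (rule lipschitz_on_continuous_on)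
qed

lemma card_mball_conv_measurable:
  assumes "finite D"
  shows "(\<lambda>(y, r). real (card (mball_conv M y r \<inter> D))) \<in> borel_measurable (\<mu> \<Otimes>\<^sub>M restrict_space borel {0..1})"
proof -
  let ?P = "\<mu> \<Otimes>\<^sub>M restrict_space borel {0..1::real}"
  have card_eq: "real (card (mball_conv M y r \<inter> D)) = (\<Sum>x\<in>D. indicator (mball_conv M y r) x)" for y r
    using assms by (simp add: indicator_def sum.If_cases Int_commute Int_def conj_commute)
  have snd [measurable]: "snd \<in> borel_measurable ?P"
    by (rule measurable_compose[OF measurable_snd measurable_restrict_space1]) simp
  have [measurable]: "(\<lambda>z. dist x (fst z)) \<in> borel_measurable ?P" for x
  proof -
    have "(\<lambda>y. dist x y) \<in> borel_measurable (restrict_space borel M)"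
      by (intro borel_measurable_continuous_on_restrict continuous_intros)
    then have "(\<lambda>y. dist x y) \<in> borel_measurable \<mu>"
      by (simp add: measurable_cong_sets[OF sets_\<mu> refl])
    then show ?thesis
      by (rule measurable_compose[OF measurable_fst])
  qed
  have "(\<lambda>z. indicator (mball_conv M (fst z) (snd z)) x :: real) \<in> borel_measurable ?P" for x
  proof -
    have "(\<lambda>z. indicator (mball_conv M (fst z) (snd z)) x :: real) =
      (\<lambda>z. if x \<in> M \<and> 0 < snd z \<and> (1 \<le> snd z \<or> dist x (fst z) < snd z) then 1 else 0)"
      by (auto simp: fun_eq_iff mball_conv_def indicator_def)
    also have "\<dots> \<in> borel_measurable ?P"
      by measurable
    finally show ?thesis .
  qed
  then show ?thesis
    unfolding card_eq split_beta by (intro borel_measurable_sum)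
qed

lemma sets_xi0: "sets xi0 = sets (restrict_space borel {0..1})"
  by (simp add: xi0_def sets_restrict_space)

lemma local_discrepancy_measurable:
  assumes "finite D"
  shows "(\<lambda>(y, r). local_discrepancy M \<mu> D y r) \<in> borel_measurable (\<mu> \<Otimes>\<^sub>M xi0)"
proof -
  have "(\<lambda>(y, r). local_discrepancy M \<mu> D y r) \<in> borel_measurable (\<mu> \<Otimes>\<^sub>M restrict_space borel {0..1})"
    using card_mball_conv_measurable[OF assms] ball_vol_measurable
    unfolding local_discrepancy_def split_beta by measurable
  then show ?thesis
    by (simp add: measurable_cong_sets[OF sets_pair_measure_cong[OF refl sets_xi0] refl])
qed

section \<open>A priori bounds for the discrepancy and the exponent\<close>

lemma abs_local_discrepancy_le:
  assumes "finite D"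
  shows "\<bar>local_discrepancy M \<mu> D y r\<bar> \<le> real (card D)"
proof -
  have "card (mball_conv M y r \<inter> D) \<le> card D"
    using assms by (simp add: card_mono)
  moreover have "0 \<le> real (card D) * ball_vol M \<mu> y r" "real (card D) * ball_vol M \<mu> y r \<le> real (card D)"
    using ball_vol_le_1 ball_vol_nonneg by (auto intro!: mult_left_le)
  ultimately show ?thesis
    unfolding local_discrepancy_def by linarith
qed

text \<open>Gives the lower bound that makes the real infimum in \<open>lambda_inf\<close>
  meaningful. Radius 0 provides one member of the supremum, which is taken over a set bounded by
  \<open>card D\<close>.\<close>

lemma Linf_discrepancy_nonneg:
  assumes "D \<in> point_sets M N"
  shows "0 \<le> Linf_discrepancy M \<mu> D"
proof -
  obtain y where y: "y \<in> M"
    using nonempty by blast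
  have "\<bar>local_discrepancy M \<mu> D y 0\<bar> \<le> Linf_discrepancy M \<mu> D"
    unfolding Linf_discrepancy_def
    using y assms abs_local_discrepancy_le[of D]
    by (intro cSUP_upper2[where x = "(y, 0)"] bdd_aboveI[where M = "real (card D)"])
       (auto simp: point_sets_def)
  then show ?thesis
    by linarith
qed

text \<open>The two conditions force \<open>r powr d / c1 \<le> c2 * r\<close>, which fails as
  \<open>r\<close> tends to 0 if \<open>d < 1\<close>. The result later bounds m^(-1-1/d) below by
  m^(-2).\<close>

lemma exponent_ge_1:
  assumes "condition_A M \<mu> d c1"
  shows "d \<ge> 1"
proof (rule ccontr)
  assume "\<not> d \<ge> 1"
  then have d: "d < 1" by simp
  have c1: "c1 > 0"
    using assms by (simp add: condition_A_def)
  obtain y where y: "y \<in> M"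
    using nonempty by blast
  have bounded: "r powr (d - 1) \<le> c1 * c2" if r: "0 < r" "r \<le> 1" for r
  proof -
    have "inverse c1 * r powr d \<le> ball_vol M \<mu> y r"
      using assms y r by (simp add: condition_A_def)
    also have "\<dots> \<le> c2 * r"
      using ball_vol_lipschitz_radius[OF y, of r 0] r by (simp add: ball_vol_0)
    finally have "r powr d \<le> c1 * c2 * r"
      using c1 by (simp add: field_simps)
    then show ?thesis
      using r by (simp add: powr_diff field_simps)
  qed
  \<comment> \<open>The radius \<open>T powr (1 / (d - 1))\<close> has \<open>T\<close> as its power
    \<open>d - 1\<close>, which exceeds \<open>c1 * c2\<close>; \<open>T \<ge> 1\<close> keeps the
    radius at most 1.\<close>
  define T where "T = max 1 (c1 * c2 + 1)"
  have "(T powr (1 / (d - 1))) powr (d - 1) \<le> c1 * c2"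
  proof (rule bounded)
    show "T powr (1 / (d - 1)) \<le> 1"
    proof -
      have "T powr (1 / (d - 1)) \<le> T powr 0"
        using d by (intro powr_mono) (auto simp: T_def)
      then show ?thesis
        by (simp add: T_def split: if_splits)
    qed
  qed (simp add: T_def)
  then show False
    using d by (simp add: powr_powr T_def)
qed

section \<open>Persistence of a large discrepancy\<close>

text \<open>The number \<open>e\<close> is any lower bound for the measure of the set on which the discrepancy persists.\<close>

lemma discrepancy_le_Lp:
  assumes A: "condition_A M \<mu> d c1" and D: "D \<in> point_sets M N" and p: "0 < p"
    and y0: "y0 \<in> M" and r0: "r0 \<in> {0..1}" and \<delta>: "0 < \<delta>"
    and e: "0 \<le> e" "e \<le> \<delta> powr (d + 1) / c1"
  shows "(\<bar>local_discrepancy M \<mu> D y0 r0\<bar> - 3 * c2 * \<delta> * real N) * e powr (1 / p)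
    \<le> Lp_discrepancy M \<mu> xi0 p D"
proof (cases "\<bar>local_discrepancy M \<mu> D y0 r0\<bar> \<le> 3 * c2 * \<delta> * real N")
  case True
  then have "(\<bar>local_discrepancy M \<mu> D y0 r0\<bar> - 3 * c2 * \<delta> * real N) * e powr (1 / p) \<le> 0"
    by (intro mult_nonpos_nonneg) auto
  also have "\<dots> \<le> Lp_discrepancy M \<mu> xi0 p D"
    by (simp add: Lp_discrepancy_def)
  finally show ?thesis .
next
  case False
  define L where "L = local_discrepancy M \<mu> D"
  have fin: "finite D" and card_D: "card D = N"
    using D by (auto simp: point_sets_def)
  have L_diff: "L y r - L z s = real (card (mball_conv M y r \<inter> D)) - real (card (mball_conv M z s \<inter> D))
      - real N * (ball_vol M \<mu> y r - ball_vol M \<mu> z s)" for y r z s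
    by (simp add: L_def local_discrepancy_def card_D algebra_simps)
  \<comment> \<open>Serves both signs: \<open>(y0, r0)\<close> is the smaller ball if its
    discrepancy is nonnegative and the larger one if it is negative. The factor 3 is one
    \<open>\<delta>\<close> for the centre and two for the radius.\<close>
  have L_step: "L y r - L z s \<le> 3 * c2 * \<delta> * real N"
    if yz: "y \<in> M" "z \<in> M" "dist y z < \<delta>" and rs: "r + \<delta> \<le> s" "s \<le> r + 2 * \<delta>" for y z r s
  proof -
    have "card (mball_conv M y r \<inter> D) \<le> card (mball_conv M z s \<inter> D)"
      using mball_conv_mono[of y z r s] yz rs fin by (intro card_mono) auto
    moreover have "ball_vol M \<mu> z s - ball_vol M \<mu> y r \<le> c2 * (3 * \<delta>)"
    proof -
      have "ball_vol M \<mu> z s - ball_vol M \<mu> y r \<le> c2 * \<bar>dist z y + s - r\<bar>"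
        using yz by (intro ball_vol_diff_le) auto
      also have "\<dots> \<le> c2 * (3 * \<delta>)"
        using yz(3) rs c2_pos \<delta> zero_le_dist[of z y] dist_commute[of z y]
        by (intro mult_left_mono) (linarith, simp)
      finally show ?thesis .
    qed
    then have "real N * (ball_vol M \<mu> z s - ball_vol M \<mu> y r) \<le> real N * (c2 * (3 * \<delta>))"
      by (intro mult_left_mono) auto
    ultimately show ?thesis
      unfolding L_diff by (simp add: algebra_simps)
  qed
  \<comment> \<open>Excludes radii within \<open>2 * \<delta>\<close> of the end of [0,1] at which
    the trivial bound for the discrepancy vanishes.\<close>
  have slack: "real N * (c2 * x) \<le> 3 * c2 * \<delta> * real N" if "x \<le> 2 * \<delta>" for x
  proof -
    have "real N * (c2 * x) \<le> real N * (c2 * (3 * \<delta>))"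
      using that c2_pos \<delta> by (intro mult_left_mono) auto
    then show ?thesis
      by (simp add: algebra_simps)
  qed
  \<comment> \<open>The strict bound also gives \<open>\<delta> < 1\<close>, so that Condition A
    applies at radius \<open>\<delta>\<close> and \<open>mball_conv M y0 \<delta>\<close> is a
    genuine metric ball.\<close>
  obtain a where a: "0 \<le> a" "a + \<delta> < 1"
    and persists: "\<And>y r. y \<in> M \<Longrightarrow> dist y y0 < \<delta> \<Longrightarrow> r \<in> {a..a + \<delta>} \<Longrightarrow>
        \<bar>L y0 r0\<bar> - 3 * c2 * \<delta> * real N \<le> \<bar>L y r\<bar>"
  proof (cases "L y0 r0 \<ge> 0")
    case True
    \<comment> \<open>At most \<open>N\<close> points are counted, so the discrepancy is at most
      \<open>N\<close> times the missing volume, which is small for \<open>r0\<close> near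
      1.\<close>
    have "L y0 r0 \<le> real N * (1 - ball_vol M \<mu> y0 r0)"
      using card_mono[OF fin, of "mball_conv M y0 r0 \<inter> D"]
      by (simp add: L_def local_discrepancy_def card_D algebra_simps)
    also have "\<dots> \<le> real N * (c2 * (1 - r0))"
      using ball_vol_lipschitz_radius[OF y0, of 1 r0] r0
      by (intro mult_left_mono) (auto simp: ball_vol_1)
    finally have "\<not> 1 - r0 \<le> 2 * \<delta>"
      using False True slack[of "1 - r0"] by (auto simp: L_def)
    then have "0 \<le> r0 + \<delta>" "r0 + \<delta> + \<delta> < 1"
      using r0 \<delta> by auto
    moreover have "\<bar>L y0 r0\<bar> - 3 * c2 * \<delta> * real N \<le> \<bar>L y r\<bar>"
      if "y \<in> M" "dist y y0 < \<delta>" "r \<in> {r0 + \<delta>..r0 + \<delta> + \<delta>}" for y r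
      using L_step[of y0 y r0 r] that True y0 by (auto simp: dist_commute)
    ultimately show ?thesis
      by (rule that)
  next
    case neg: False
    \<comment> \<open>The count is nonnegative, so the deficit is at most \<open>N\<close> times the
      volume, which is small for \<open>r0\<close> near 0.\<close>
    have "- L y0 r0 \<le> real N * ball_vol M \<mu> y0 r0"
      by (simp add: L_def local_discrepancy_def card_D)
    also have "\<dots> \<le> real N * (c2 * r0)"
      using ball_vol_lipschitz_radius[OF y0, of r0 0] r0
      by (intro mult_left_mono) (auto simp: ball_vol_0)
    finally have "\<not> r0 \<le> 2 * \<delta>"
      using False neg slack[of r0] by (auto simp: L_def)
    then have "0 \<le> r0 - 2 * \<delta>" "r0 - 2 * \<delta> + \<delta> < 1"
      using r0 \<delta> by auto
    moreover have "\<bar>L y0 r0\<bar> - 3 * c2 * \<delta> * real N \<le> \<bar>L y r\<bar>"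
      if "y \<in> M" "dist y y0 < \<delta>" "r \<in> {r0 - 2 * \<delta>..r0 - 2 * \<delta> + \<delta>}" for y r
      using L_step[of y y0 r r0] that neg y0 by auto
    ultimately show ?thesis
      by (rule that)
  qed
  \<comment> \<open>The centres contribute at least \<open>\<delta> powr d / c1\<close> and the
    radii exactly \<open>\<delta>\<close>, whence the exponent \<open>d + 1\<close>.\<close>
  define E where "E = mball_conv M y0 \<delta> \<times> {a..a + \<delta>}"
  have I: "{a..a + \<delta>} \<in> sets xi0"
    using a by (auto simp: xi0_def sets_restrict_space_iff)
  have E: "E \<in> sets (\<mu> \<Otimes>\<^sub>M xi0)"
    unfolding E_def by (intro pair_measureI I mball_conv_sets)
  have "measure xi0 {a..a + \<delta>} = \<delta>"
    using a \<delta> by (simp add: xi0_def measure_restrict_space)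
  then have "measure (\<mu> \<Otimes>\<^sub>M xi0) E = ball_vol M \<mu> y0 \<delta> * \<delta>"
    unfolding E_def ball_vol_def
    using xi0.emeasure_pair_measure_Times[OF mball_conv_sets[of y0 \<delta>] I]
    by (simp add: measure_def enn2real_mult)
  moreover have "inverse c1 * \<delta> powr d * \<delta> \<le> ball_vol M \<mu> y0 \<delta> * \<delta>"
    using A y0 \<delta> a by (intro mult_right_mono) (auto simp: condition_A_def)
  ultimately have measure_E: "e \<le> measure (\<mu> \<Otimes>\<^sub>M xi0) E"
    using e \<delta> by (simp add: powr_add field_simps)
  have "(\<bar>L y0 r0\<bar> - 3 * c2 * \<delta> * real N) * e powr (1 / p)
      \<le> (LINT z|(\<mu> \<Otimes>\<^sub>M xi0). \<bar>(\<lambda>(y, r). L y r) z\<bar> powr p) powr (1 / p)"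
  proof (rule prod.lower_bound_le_Lp_norm[OF _ _ E _ _ p e(1) measure_E])
    show "(\<lambda>(y, r). L y r) \<in> borel_measurable (\<mu> \<Otimes>\<^sub>M xi0)"
      unfolding L_def using fin by (rule local_discrepancy_measurable)
    show "\<bar>(\<lambda>(y, r). L y r) z\<bar> \<le> real N" for z
      using abs_local_discrepancy_le[OF fin] by (auto simp: L_def card_D split: prod.split)
    show "0 \<le> \<bar>L y0 r0\<bar> - 3 * c2 * \<delta> * real N"
      using False by (simp add: L_def)
    show "\<bar>L y0 r0\<bar> - 3 * c2 * \<delta> * real N \<le> \<bar>(\<lambda>(y, r). L y r) z\<bar>" if "z \<in> E" for z
    proof -
      obtain y r where z: "z = (y, r)" "y \<in> mball_conv M y0 \<delta>" "r \<in> {a..a + \<delta>}"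
        using \<open>z \<in> E\<close> by (auto simp: E_def)
      have "y \<in> M" "dist y y0 < \<delta>"
        using z(2) a \<delta> by (auto simp: mball_conv_def split: if_splits)
      then show ?thesis
        using persists z by simp
    qed
  qed
  then show ?thesis
    by (simp add: Lp_discrepancy_def L_def case_prod_unfold)
qed

end

section \<open>Choice of the scale and passage to the infima\<close>

theorem proposition1p2:
  fixes M :: "'a::metric_space set" and \<mu> :: "'a measure" and d c1 c2 :: real
  assumes "normalized_metric_measure_space M \<mu>"
    and "connected M"
    and "condition_A M \<mu> d c1"
    and "condition_B M \<mu> c2"
  shows "\<exists>c4>0. \<exists>c5>0.
     (\<forall>N::nat. N \<ge> 1 \<longrightarrow> (\<forall>D \<in> point_sets M N. \<forall>p::real. 1 < p \<longrightarrow> (\<forall>m::nat. real m \<ge> c5 \<longrightarrow>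
        Linf_discrepancy M \<mu> D
          \<le> 2 * real m powr (2 / p) * Lp_discrepancy M \<mu> xi0 p D
             + c4 * real N * real m powr (- 1 / d)))) \<and>
     (\<forall>N::nat. N \<ge> 1 \<longrightarrow> (\<forall>p::real. 1 < p \<longrightarrow> (\<forall>m::nat. real m \<ge> c5 \<longrightarrow>
        lambda_inf M \<mu> N
          \<le> 2 * real m powr (2 / p) * lambda_p M \<mu> xi0 p N
             + c4 * real N * real m powr (- 1 / d))))"
proof -
  interpret ball_lipschitz_space M \<mu> c2
    using assms by unfold_locales
  obtain y0 where y0: "y0 \<in> M"
    using nonempty by blast
  have d: "d \<ge> 1" and c1: "c1 > 0"
    using exponent_ge_1[OF assms(3)] assms(3) by (auto simp: condition_A_def)
  \<comment> \<open>As \<open>C\<close> is at least 1 and at least \<open>c1\<close>,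
    \<open>C powr (d + 1)\<close> absorbs the factor \<open>1 / c1\<close> in the measure bound. The
    constant \<open>c4\<close> comes from the loss \<open>3 * c2 * \<delta>\<close> at the scale
    \<open>\<delta>\<close> chosen below.\<close>
  define C where "C = max 1 c1"
  define c4 where "c4 = 3 * c2 * C"
  have "c4 > 0"
    using c2_pos by (simp add: c4_def C_def)
  have bound: "Linf_discrepancy M \<mu> D
          \<le> 2 * real m powr (2 / p) * Lp_discrepancy M \<mu> xi0 p D
             + c4 * real N * real m powr (- 1 / d)"
    if D: "D \<in> point_sets M N" and p: "1 < p" and m: "real m \<ge> 1" for N D p m
  proof -
    \<comment> \<open>At this scale \<open>\<delta> powr (d + 1) / c1\<close> is at least
      m^(-1-1/d), hence at least m^(-2).\<close>
    define \<delta> where "\<delta> = C * real m powr (- 1 / d)"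
    have \<delta>: "\<delta> > 0"
      using m by (simp add: \<delta>_def C_def)
    have "real m powr (- 2) \<le> real m powr (- 1 - 1 / d)"
      using m d by (intro powr_mono) (auto simp: field_simps)
    also have "\<dots> = real m powr (- 1 / d * (d + 1))"
      using d by (intro arg_cong[where f = "\<lambda>x. real m powr x"]) (simp add: field_simps)
    also have "\<dots> \<le> (C powr (d + 1) / c1) * real m powr (- 1 / d * (d + 1))"
    proof -
      have "c1 \<le> C powr 1"
        by (simp add: C_def)
      also have "\<dots> \<le> C powr (d + 1)"
        using d by (intro powr_mono) (auto simp: C_def)
      finally have "1 \<le> C powr (d + 1) / c1"
        using c1 by simp
      then show ?thesis
        using mult_right_mono[of 1 "C powr (d + 1) / c1" "real m powr (- 1 / d * (d + 1))"] by simp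
    qed
    also have "\<dots> = \<delta> powr (d + 1) / c1"
      using m by (simp add: \<delta>_def C_def powr_mult powr_powr)
    finally have vol: "real m powr (- 2) \<le> \<delta> powr (d + 1) / c1" .
    have card_D: "card D = N"
      using D by (simp add: point_sets_def)
    have "\<bar>local_discrepancy M \<mu> D y r\<bar> \<le> real m powr (2 / p) * Lp_discrepancy M \<mu> xi0 p D + 3 * c2 * \<delta> * real N"
      if y: "y \<in> M" and r: "r \<in> {0..1}" for y r
    proof -
      have *: "\<bar>local_discrepancy M \<mu> D y r\<bar> * (real m powr (- 2)) powr (1 / p) \<le> Lp_discrepancy M \<mu> xi0 p D
         + 3 * c2 * \<delta> * real N * (real m powr (- 2)) powr (1 / p)"
        using discrepancy_le_Lp[OF assms(3) D _ y r \<delta> _ vol, of p] p m by (simp add: algebra_simps)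
      \<comment> \<open>The measure bound in use is m^(-2), so multiplying by m^(2/p) clears its
        root.\<close>
      have "real m powr (2 / p) * (real m powr (- 2)) powr (1 / p) = 1"
        using m by (simp add: powr_powr flip: powr_add)
      then have **: "(real m powr (- 2)) powr (1 / p) * real m powr (2 / p) = 1"
        by (simp add: mult.commute)
      have "\<bar>local_discrepancy M \<mu> D y r\<bar> * ((real m powr (- 2)) powr (1 / p) * real m powr (2 / p))
         \<le> Lp_discrepancy M \<mu> xi0 p D * real m powr (2 / p)
          + 3 * c2 * \<delta> * real N * ((real m powr (- 2)) powr (1 / p) * real m powr (2 / p))"
        using mult_right_mono[OF *, of "real m powr (2 / p)"] by (simp add: algebra_simps)
      then show ?thesis
        unfolding ** by (simp add: algebra_simps)
    qed
    then have "Linf_discrepancy M \<mu> D \<le> real m powr (2 / p) * Lp_discrepancy M \<mu> xi0 p D + 3 * c2 * \<delta> * real N"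
      unfolding Linf_discrepancy_def using nonempty by (intro cSUP_least) auto
    \<comment> \<open>The coefficient reached so far is 1; nonnegativity of this term weakens it to
      the stated 2.\<close>
    moreover have "0 \<le> real m powr (2 / p) * Lp_discrepancy M \<mu> xi0 p D"
      by (simp add: Lp_discrepancy_def)
    ultimately show ?thesis
      by (simp add: c4_def \<delta>_def algebra_simps)
  qed
  have "lambda_inf M \<mu> N
          \<le> 2 * real m powr (2 / p) * lambda_p M \<mu> xi0 p N
             + c4 * real N * real m powr (- 1 / d)"
    if p: "1 < p" and m: "real m \<ge> 1" for N p m
  proof -
    have ne: "point_sets M N \<noteq> {}"
      using infinite_arbitrarily_large[OF infinite_carrier[OF assms(2)], of N]
      by (auto simp: point_sets_def)
    define K where "K = 2 * real m powr (2 / p)"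
    have K: "K > 0"
      using m by (simp add: K_def)
    \<comment> \<open>Solved for the \<open>Lp_discrepancy\<close>, the bound has a left side
      independent of \<open>D\<close> and so passes to the infimum over the nonempty family.\<close>
    have "(lambda_inf M \<mu> N - c4 * real N * real m powr (- 1 / d)) / K \<le> Lp_discrepancy M \<mu> xi0 p D"
      if D: "D \<in> point_sets M N" for D
    proof -
      have "lambda_inf M \<mu> N \<le> Linf_discrepancy M \<mu> D"
        unfolding lambda_inf_def using D Linf_discrepancy_nonneg
        by (intro cINF_lower bdd_belowI[where m = 0]) auto
      then show ?thesis
        using bound[OF D p m] K by (simp add: field_simps flip: K_def)
    qed
    then have "(lambda_inf M \<mu> N - c4 * real N * real m powr (- 1 / d)) / K \<le> lambda_p M \<mu> xi0 p N"
      unfolding lambda_p_def using ne by (intro cINF_greatest) auto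
    then show ?thesis
      using K by (simp add: field_simps flip: K_def)
  qed
  \<comment> \<open>The choice \<open>c5 = 1\<close> suffices, since the estimates ask only for
    \<open>real m \<ge> 1\<close>.\<close>
  with bound \<open>c4 > 0\<close> show ?thesis
    by (intro exI[of _ c4] exI[of _ 1] conjI allI ballI impI) auto
qed

end
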